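(* Let $w\in\mathbb{N}_0$ and suppose the move costs satisfy $w_{n,0}=1=w_{n,2}$ and $w_{n,1}=w$ for all $n\in\mathbb{N}_0$. Let $(a_m)_{m\in\mathbb{N}_0}$ be defined by $a_0=0$, $a_{m+1}=2\cdot3^m$, and suppose $a_m\le w<a_{m+1}$ for some $m\in\mathbb{N}_0$. Then the vectors $d_n=(d_{n,0},d_{n,1},d_{n,2})^{\mathrm t}$ of minimal costs are given by $$d_n=(N_n,\,2N_n,\,N_n)^{\mathrm t}\qquad\text{if }0\le n\le m,$$ $$d_n=\begin{pmatrix}N_mJ_{n-m+2}+\ell_{n-m}+w\,\ell_{n-m-1}\\ 2N_mJ_{n-m+1}+2\ell_{n-m-1}+2w\,\ell_{n-m-2}+w\\ N_mJ_{n-m+2}+\ell_{n-m}+w\,\ell_{n-m-1}\end{pmatrix}\qquad\text{if }n>m.$$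
   Context: Sequences: $N_n=\frac12(3^n-1)$; $J_n=\frac13(2^n-(-1)^n)$ for $n\in\mathbb{N}_0$ (Jacobsthal numbers); $\ell_n=\sum_{\nu=0}^nJ_\nu$ for $n\ge-1$, so $\ell_{-1}=0$ (Lichtenberg numbers). Weighted Tower of Hanoi: $\mathbb{N}_0$ denotes the nonnegative integers; $T=\{0,1,2\}$ is the set of pegs; discs are labelled $1,2,3,\dots$ by increasing size. A state with $n$ discs is an assignment of the discs $1,\dots,n$ to the pegs, the discs on each peg being stacked with smaller discs above larger ones. A legal move transfers the topmost (smallest) disc of one peg to a different peg carrying no smaller disc. For $i\in T$, $i^n$ is the perfect state with all $n$ discs on peg $i$. For $\{i,j,k\}=T$ and $n\in\mathbb{N}_0$, $w_{n,k}\in[0,\infty)$ is a given cost of a single move of disc $n+1$ between pegs $i$ and $j$ (in either direction), and $d_{n,k}$ is the minimal total cost, over all finite sequences of legal moves, of getting from $i^n$ to $j^n$ with $n$ discs. *)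

theory Defs
  imports Complex_Main "HOL-Library.FuncSet"
begin

definition pegs :: "nat set" where
  "pegs = {0, 1, 2}"

definition states :: "nat \<Rightarrow> (nat \<Rightarrow> nat) set" where
  "states n = {1..n} \<rightarrow>\<^sub>E pegs"

definition perfect :: "nat \<Rightarrow> nat \<Rightarrow> (nat \<Rightarrow> nat)" where
  "perfect n i = (\<lambda>d\<in>{1..n}. i)"

text \<open>Disc \<open>d\<close> is topmost on its peg iff no smaller disc lies on that peg.\<close>

definition legal_move ::
    "nat \<Rightarrow> (nat \<Rightarrow> nat) \<Rightarrow> nat \<Rightarrow> nat \<Rightarrow> nat \<Rightarrow> (nat \<Rightarrow> nat) \<Rightarrow> bool" where
  "legal_move n s d i j t \<longleftrightarrow>
     s \<in> states n \<and> d \<in> {1..n} \<and> s d = i \<and> j \<in> pegs \<and> i \<noteq> j \<and>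
     (\<forall>e\<in>{1..<d}. s e \<noteq> i \<and> s e \<noteq> j) \<and> t = s(d := j)"

text \<open>
  \<open>solution w n s c t\<close>: some finite sequence of legal moves of total cost \<open>c\<close> leads from
  \<open>s\<close> to \<open>t\<close>. A move of disc \<open>Suc r\<close> costs \<open>w r k\<close>, where \<open>k\<close> is the peg not involved in
  the move.
\<close>

inductive solution ::
    "(nat \<Rightarrow> nat \<Rightarrow> real) \<Rightarrow> nat \<Rightarrow> (nat \<Rightarrow> nat) \<Rightarrow> real \<Rightarrow> (nat \<Rightarrow> nat) \<Rightarrow> bool"
  for w :: "nat \<Rightarrow> nat \<Rightarrow> real" and n :: nat where
  empty: "s \<in> states n \<Longrightarrow> solution w n s 0 s"
| step: "solution w n s c t \<Longrightarrow> legal_move n t (Suc r) i j u \<Longrightarrow> {i, j, k} = pegs \<Longrightarrow>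
    solution w n s (c + w r k) u"

text \<open>
  For nonnegative \<open>w\<close> and pegs \<open>i\<close>, \<open>j\<close> the minimum exists, since the state graph is finite
  and connected.
\<close>

definition min_cost :: "(nat \<Rightarrow> nat \<Rightarrow> real) \<Rightarrow> nat \<Rightarrow> nat \<Rightarrow> nat \<Rightarrow> real" where
  "min_cost w n i j = (LEAST c. solution w n (perfect n i) c (perfect n j))"

definition N :: "nat \<Rightarrow> real" where
  "N n = (3 ^ n - 1) / 2"

definition jacobsthal :: "nat \<Rightarrow> real" where
  "jacobsthal n = (2 ^ n - (-1) ^ n) / 3"

text \<open>Integer index, so that \<open>lichtenberg (-1) = 0\<close> as an empty sum.\<close>

definition lichtenberg :: "int \<Rightarrow> real" where
  "lichtenberg n = (\<Sum>\<nu>\<in>{0..n}. jacobsthal (nat \<nu>))"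

primrec threshold :: "nat \<Rightarrow> nat" where
  "threshold 0 = 0"
| "threshold (Suc m) = 2 * 3 ^ m"

end

theory Submission
  imports Defs
begin

text \<open>
  Everything rests on one recursion, \<open>min_cost_Suc\<close>: an optimal transfer of \<open>n + 1\<close> discs from
  \<open>i\<close> to \<open>j\<close> moves the largest disc either once (the tower of smaller discs goes
  \<open>i\<close>, \<open>k\<close>, \<open>j\<close>) or twice, via \<open>k\<close> (the tower goes \<open>i\<close>, \<open>j\<close>, \<open>i\<close>, \<open>j\<close>). That nothing else can be
  cheaper is seen by looking only at the first and the last move of the largest disc: at these two
  moments the smaller discs form a tower on the peg which that move avoids, and the triangle
  inequality for \<open>min_cost\<close> bounds the cost of all that happens in between
  (\<open>solution_Suc_decompose\<close>). Minimality and the existence of the minimum are proved together, by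
  induction on \<open>n\<close>.

  If pegs \<open>0\<close> and \<open>2\<close> play symmetric roles, the recursion becomes
  \<open>x' = min (x + y + 1) (3 x + 1 + w)\<close>, \<open>y' = min (2 x + w) (3 y + 2)\<close>, where \<open>x\<close> and \<open>y\<close> are
  the costs of transfers avoiding peg \<open>0\<close> (or \<open>2\<close>) and peg \<open>1\<close>. Since \<open>y \<le> 2 x\<close> always holds, the
  first minimum is its first entry. In the second minimum the detour \<open>3 y + 2\<close> of the largest disc
  wins as long as \<open>w\<close> is at least \<open>2 * 3 ^ n\<close>, which gives \<open>x = N n\<close>, \<open>y = 2 * N n\<close>; once \<open>w\<close> is
  smaller, the direct move wins for that disc and, because \<open>2 x + w \<le> 3 y + 2\<close> is then inherited, for
  all larger discs. The resulting linear recursion \<open>x' = x + y + 1\<close>, \<open>y' = 2 x + w\<close> is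
  the one satisfied by the Jacobsthal and Lichtenberg expressions.
\<close>

section \<open>Solutions with one additional, largest disc\<close>

lemma pegs_distinct:
  assumes "{i, j, k} = pegs"
  shows "i \<in> pegs" "j \<in> pegs" "k \<in> pegs" "i \<noteq> j" "i \<noteq> k" "j \<noteq> k"
proof -
  have "card {i, j, k} = 3"
    using assms by (simp add: pegs_def)
  then show "i \<noteq> j" "i \<noteq> k" "j \<noteq> k"
    by (auto simp: card_insert_if split: if_splits)
  show "i \<in> pegs" "j \<in> pegs" "k \<in> pegs"
    by (simp_all flip: assms)
qed

lemma third_peg:
  assumes "i \<in> pegs" "j \<in> pegs" "i \<noteq> j"
  obtains k where "{i, j, k} = pegs"
  using assms that[of 0] that[of 1] that[of 2] unfolding pegs_def by auto

lemma perfect_in_states: "i \<in> pegs \<Longrightarrow> perfect n i \<in> states n"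
  by (auto simp: perfect_def states_def)

lemma perfect_Suc: "perfect (Suc n) i = (perfect n i)(Suc n := i)"
  by (auto simp: perfect_def fun_eq_iff)

lemma state_extend: "s \<in> states n \<Longrightarrow> p \<in> pegs \<Longrightarrow> s(Suc n := p) \<in> states (Suc n)"
  unfolding states_def by (auto simp: PiE_iff extensional_def)

lemma solution_nonneg:
  assumes "solution w n s c t" and "\<forall>r. \<forall>k\<in>pegs. w r k \<ge> 0"
  shows "c \<ge> 0"
  using assms(1)
  by induction (use assms(2) pegs_distinct(3) in \<open>auto intro!: add_nonneg_nonneg\<close>)

lemma solution_trans:
  assumes "solution w n t c' u" and "solution w n s c t"
  shows "solution w n s (c + c') u"
  using assms
proof induction
  case (step t c' t' r i j u k)
  then have "solution w n s ((c + c') + w r k) u"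
    by (blast intro: solution.step)
  then show ?case by (simp add: add.assoc)
qed simp

lemma solution_extend:
  assumes "solution w n s c t" and "p \<in> pegs"
  shows "solution w (Suc n) (s(Suc n := p)) c (t(Suc n := p))"
  using assms(1)
proof induction
  case (empty s)
  then show ?case using assms(2) by (intro solution.empty state_extend)
next
  case (step s c t r i j u k)
  have "legal_move (Suc n) (t(Suc n := p)) (Suc r) i j (u(Suc n := p))"
    using step(2) state_extend[OF _ assms(2)]
    by (auto simp: legal_move_def fun_eq_iff)
  then show ?case using step by (blast intro: solution.step)
qed

lemma solution_largest_disc:
  assumes "{p, q, r} = pegs"
  shows "solution w (Suc n) ((perfect n r)(Suc n := p)) (w n r) ((perfect n r)(Suc n := q))"
proof -
  note d = pegs_distinct[OF assms]
  have st: "(perfect n r)(Suc n := p) \<in> states (Suc n)"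
    using d by (intro state_extend perfect_in_states)
  moreover have "legal_move (Suc n) ((perfect n r)(Suc n := p)) (Suc n) p q
      ((perfect n r)(Suc n := q))"
    using st d by (auto simp: legal_move_def perfect_def)
  ultimately show ?thesis
    using solution.step[OF solution.empty _ assms] by fastforce
qed

text \<open>
  A move of the largest disc from \<open>p\<close> to \<open>j\<close> needs both pegs to be free of smaller discs, so all of
  these lie on the third peg; any other move takes place among the smaller discs alone.
\<close>

lemma legal_move_Suc_cases:
  assumes "legal_move (Suc n) (s(Suc n := p)) d i j u" and "s \<in> states n" and "p \<in> pegs"
  obtains (largest) r where "d = Suc n" "i = p" "{p, j, r} = pegs" "s = perfect n r"
      "u = s(Suc n := j)"
    | (smaller) s' where "legal_move n s d i j s'" "u = s'(Suc n := p)"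
proof (cases "d = Suc n")
  case True
  have ij: "i = p" "j \<in> pegs" "p \<noteq> j" "u = s(Suc n := j)"
    and free: "\<forall>e\<in>{1..<Suc n}. (s(Suc n := p)) e \<noteq> p \<and> (s(Suc n := p)) e \<noteq> j"
    using assms(1) True unfolding legal_move_def by auto
  obtain r where r: "{p, j, r} = pegs"
    using third_peg[OF assms(3) ij(2,3)] .
  have "s e = perfect n r e" for e
  proof (cases "e \<in> {1..n}")
    case True
    then have "s e \<in> pegs" using assms(2) by (auto simp: states_def)
    moreover have "s e \<noteq> p" "s e \<noteq> j" using free True by auto
    ultimately show ?thesis using r True by (auto simp: perfect_def)
  next
    case False
    then show ?thesis using assms(2) by (auto simp: states_def perfect_def PiE_iff extensional_def)
  qed
  then show ?thesis using largest[of r] True ij r by auto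
next
  case False
  then have "legal_move n s d i j (s(d := j))" "u = (s(d := j))(Suc n := p)"
    using assms(1,2) unfolding legal_move_def by (auto simp: fun_eq_iff)
  then show ?thesis by (rule smaller)
qed

lemma legal_move_states:
  assumes "legal_move n s d i j t"
  shows "t \<in> states n"
  using assms by (auto simp: legal_move_def states_def PiE_iff extensional_def)

section \<open>The recursion for the minimal costs\<close>

text \<open>
  The induction hypothesis of the recursion: the \<open>LEAST\<close> in \<open>min_cost\<close> is really attained.
\<close>

definition min_cost_attained :: "(nat \<Rightarrow> nat \<Rightarrow> real) \<Rightarrow> nat \<Rightarrow> bool" where
  "min_cost_attained w n \<longleftrightarrow> (\<forall>i\<in>pegs. \<forall>j\<in>pegs.
     solution w n (perfect n i) (min_cost w n i j) (perfect n j) \<and>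
     (\<forall>c. solution w n (perfect n i) c (perfect n j) \<longrightarrow> min_cost w n i j \<le> c))"

lemma min_cost_eqI:
  assumes "solution w n (perfect n i) c (perfect n j)"
    and "\<And>c'. solution w n (perfect n i) c' (perfect n j) \<Longrightarrow> c \<le> c'"
  shows "min_cost w n i j = c"
  unfolding min_cost_def by (rule Least_equality) (use assms in auto)

lemma min_cost_self:
  assumes "\<forall>r. \<forall>k\<in>pegs. w r k \<ge> 0" and "i \<in> pegs"
  shows "min_cost w n i i = 0"
  by (intro min_cost_eqI solution.empty perfect_in_states assms)
     (rule solution_nonneg[OF _ assms(1)])

lemma min_cost_triangle:
  assumes "min_cost_attained w n" and "i \<in> pegs" "j \<in> pegs" "k \<in> pegs"
  shows "min_cost w n i j \<le> min_cost w n i k + min_cost w n k j"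
  using assms solution_trans unfolding min_cost_attained_def by blast

text \<open>
  Here \<open>q\<close> and \<open>r\<close> are the pegs carrying the tower of smaller discs at the first and at the last
  move of the largest disc so far. If they differ, these are two different moves and both are paid
  for; if they agree, the two moves may coincide and only one of them is counted. The cost of
  everything between them is at least that of bringing the tower from \<open>q\<close> to \<open>r\<close>.
\<close>

lemma solution_Suc_decompose:
  assumes nonneg: "\<forall>r. \<forall>k\<in>pegs. w r k \<ge> 0" and att: "min_cost_attained w n" and i: "i \<in> pegs"
    and "solution w (Suc n) (perfect (Suc n) i) c u"
  shows "\<exists>s p. s \<in> states n \<and> p \<in> pegs \<and> u = s(Suc n := p) \<and>
    (p = i \<and> solution w n (perfect n i) c s \<or>
     (\<exists>q r e. q \<in> pegs - {i} \<and> r \<in> pegs - {p} \<and> solution w n (perfect n r) e s \<and>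
       min_cost w n i q + w n q + min_cost w n q r + (if q = r then 0 else w n r) + e \<le> c))"
  using assms(4)
proof (induction "perfect (Suc n) i" c u)
  case empty
  then show ?case
    using i by (intro exI[of _ "perfect n i"] exI[of _ i])
      (auto simp: perfect_Suc perfect_in_states intro: solution.empty)
next
  case (step c t d a b u k)
  have nn: "w r k \<ge> 0" if "k \<in> pegs" for r k
    using nonneg that by blast
  from step(2) obtain s p where s: "s \<in> states n" and p: "p \<in> pegs" and t: "t = s(Suc n := p)"
    and hyp: "p = i \<and> solution w n (perfect n i) c s \<or>
     (\<exists>q r e. q \<in> pegs - {i} \<and> r \<in> pegs - {p} \<and> solution w n (perfect n r) e s \<and>
       min_cost w n i q + w n q + min_cost w n q r + (if q = r then 0 else w n r) + e \<le> c)"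
    by blast
  have least: "min_cost w n x y \<le> e"
    if "solution w n (perfect n x) e (perfect n y)" "x \<in> pegs" "y \<in> pegs" for x y e
    using att that unfolding min_cost_attained_def by blast
  from step(3) s p show ?case unfolding t
  proof (cases rule: legal_move_Suc_cases)
    case (largest r')
    note d = pegs_distinct[OF largest(3)]
    have k: "k = r'"
      using largest(2,3) step(4) pegs_distinct[OF step(4)] d by auto
    have extended: "\<exists>q r e. q \<in> pegs - {i} \<and> r \<in> pegs - {b} \<and> solution w n (perfect n r) e s \<and>
       min_cost w n i q + w n q + min_cost w n q r + (if q = r then 0 else w n r) + e
         \<le> c + w d k"
      if "q \<in> pegs - {i}"
        "min_cost w n i q + w n q + min_cost w n q r' + (if q = r' then 0 else w n r')
          \<le> c + w n r'" for q
      using that d k largest(1,4) s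
      by (intro exI[of _ q] exI[of _ r'] exI[of _ 0]) (auto intro: solution.empty)
    from hyp have "\<exists>q. q \<in> pegs - {i} \<and>
        min_cost w n i q + w n q + min_cost w n q r' + (if q = r' then 0 else w n r')
          \<le> c + w n r'"
    proof (elim disjE exE conjE)
      assume "p = i" "solution w n (perfect n i) c s"
      \<comment> \<open>This is the first move of the largest disc, so the first and the last one coincide.\<close>
      then show ?thesis
        using d least[of i c r'] i largest(4) min_cost_self[OF nonneg d(3)]
        by (intro exI[of _ r']) auto
    next
      fix q r e
      assume q: "q \<in> pegs - {i}" and r: "r \<in> pegs - {p}" and sol: "solution w n (perfect n r) e s"
        and le: "min_cost w n i q + w n q + min_cost w n q r + (if q = r then 0 else w n r) + e \<le> c"
      \<comment> \<open>The move at \<open>r\<close> stops being the last one; its cost is dropped and the tower's two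
        journeys \<open>q\<close>, \<open>r\<close> and \<open>r\<close>, \<open>r'\<close> are merged.\<close>
      have "min_cost w n r r' \<le> e"
        using least[of r e r'] sol largest(4) r d by auto
      moreover have "min_cost w n q r' \<le> min_cost w n q r + min_cost w n r r'"
        using min_cost_triangle[OF att] q r d by auto
      ultimately show ?thesis
        using q r d le nn[of r n] nn[of r' n] by (intro exI[of _ q]) (auto split: if_splits)
    qed
    then obtain q where "q \<in> pegs - {i}"
        "min_cost w n i q + w n q + min_cost w n q r' + (if q = r' then 0 else w n r')
          \<le> c + w n r'"
      by (elim exE conjE)
    from extended[OF this] show ?thesis
      using s d(2) largest(5) by - (rule exI[of _ s], rule exI[of _ b], intro conjI disjI2)
  next
    case (smaller s')
    have ext: "solution w n x (e + w d k) s'" if "solution w n x e s" for x e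
      using solution.step[OF that smaller(1) step(4)] .
    have s': "s' \<in> states n" using legal_move_states[OF smaller(1)] .
    from hyp show ?thesis
    proof (elim disjE exE conjE)
      assume "p = i" "solution w n (perfect n i) c s"
      then show ?thesis using ext s' p smaller(2) by blast
    next
      fix q r e
      assume "q \<in> pegs - {i}" "r \<in> pegs - {p}" and sol: "solution w n (perfect n r) e s"
        and "min_cost w n i q + w n q + min_cost w n q r + (if q = r then 0 else w n r) + e \<le> c"
      then show ?thesis
        using ext[OF sol] s' p smaller(2)
        by (intro exI[of _ s'] exI[of _ p] conjI disjI2 exI[of _ q] exI[of _ r]
              exI[of _ "e + w d k"]) auto
    qed
  qed
qed

lemma solution_move_once:
  assumes "min_cost_attained w n" and "{i, j, k} = pegs"
  shows "solution w (Suc n) (perfect (Suc n) i)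
    (min_cost w n i k + w n k + min_cost w n k j) (perfect (Suc n) j)"
proof -
  note d = pegs_distinct[OF assms(2)]
  have tower: "solution w (Suc n) ((perfect n x)(Suc n := p)) (min_cost w n x y)
      ((perfect n y)(Suc n := p))" if "x \<in> pegs" "y \<in> pegs" "p \<in> pegs" for x y p
    using assms(1) that solution_extend unfolding min_cost_attained_def by blast
  note largest = solution_largest_disc[OF assms(2), of w n]
  show ?thesis
    unfolding perfect_Suc
    by (intro solution_trans[OF tower] solution_trans[OF largest] tower d)
qed

lemma solution_move_twice:
  assumes "min_cost_attained w n" and "{i, j, k} = pegs"
  shows "solution w (Suc n) (perfect (Suc n) i)
    (min_cost w n i j + w n j + min_cost w n j i + w n i + min_cost w n i j)
    (perfect (Suc n) j)"
proof -
  note d = pegs_distinct[OF assms(2)]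
  have tower: "solution w (Suc n) ((perfect n x)(Suc n := p)) (min_cost w n x y)
      ((perfect n y)(Suc n := p))" if "x \<in> pegs" "y \<in> pegs" "p \<in> pegs" for x y p
    using assms(1) that solution_extend unfolding min_cost_attained_def by blast
  have "{i, k, j} = pegs" "{k, j, i} = pegs" using assms(2) by auto
  note largest = this[THEN solution_largest_disc, of w n]
  show ?thesis
    unfolding perfect_Suc
    by (intro solution_trans[OF tower] solution_trans[OF largest(1)]
          solution_trans[OF largest(2)] tower d)
qed

text \<open>
  The four combinations of first and last move of the largest disc. Two of them are the two
  strategies themselves, the other two reduce to the single direct move by the triangle inequality.
\<close>

lemma solution_Suc_ge:
  assumes nonneg: "\<forall>r. \<forall>k\<in>pegs. w r k \<ge> 0" and att: "min_cost_attained w n" and pegs: "{i, j, k} = pegs"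
    and sol: "solution w (Suc n) (perfect (Suc n) i) c (perfect (Suc n) j)"
  shows "min (min_cost w n i k + w n k + min_cost w n k j)
    (min_cost w n i j + w n j + min_cost w n j i + w n i + min_cost w n i j) \<le> c"
proof -
  note d = pegs_distinct[OF pegs]
  have nn: "w r k \<ge> 0" if "k \<in> pegs" for r k
    using nonneg that by blast
  obtain s p where s: "s \<in> states n" and eq: "(perfect n j)(Suc n := j) = s(Suc n := p)"
    and cases: "p = i \<and> solution w n (perfect n i) c s \<or>
     (\<exists>q r e. q \<in> pegs - {i} \<and> r \<in> pegs - {p} \<and> solution w n (perfect n r) e s \<and>
       min_cost w n i q + w n q + min_cost w n q r + (if q = r then 0 else w n r) + e \<le> c)"
    using solution_Suc_decompose[OF nonneg att d(1) sol] unfolding perfect_Suc by blast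
  have p: "p = j" using fun_cong[OF eq, of "Suc n"] by simp
  have undef: "x (Suc n) = undefined" if "x \<in> states n" for x
    using that by (auto simp: states_def PiE_iff extensional_def)
  have "s = perfect n j"
  proof
    fix e
    show "s e = perfect n j e"
      using fun_cong[OF eq, of e] undef[OF s] undef[OF perfect_in_states[OF d(2)]]
      by (cases "e = Suc n") auto
  qed
  with cases p d obtain q r e where q: "q \<in> pegs" "q \<noteq> i" and r: "r \<in> pegs" "r \<noteq> j"
    and e: "solution w n (perfect n r) e (perfect n j)"
    and le: "min_cost w n i q + w n q + min_cost w n q r + (if q = r then 0 else w n r) + e \<le> c"
    by auto
  have "min_cost w n r j \<le> e"
    using att e r d unfolding min_cost_attained_def by blast
  then have le: "min_cost w n i q + w n q + min_cost w n q r + (if q = r then 0 else w n r)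
      + min_cost w n r j \<le> c"
    using le by simp
  have "q = j \<or> q = k" "r = i \<or> r = k" using q r pegs by auto
  then consider "q = k" "r = k" | "q = k" "r = i" | "q = j" "r = i" | "q = j" "r = k"
    by blast
  then show ?thesis
  proof cases
    case 1
    then show ?thesis using le min_cost_self[OF nonneg d(3)] by auto
  next
    case 2
    have "min_cost w n k j \<le> min_cost w n k i + min_cost w n i j"
      using min_cost_triangle[OF att] d by blast
    then show ?thesis using le 2 d nn[of i n] by auto
  next
    case 3
    then show ?thesis using le d by auto
  next
    case 4
    have "min_cost w n i k \<le> min_cost w n i j + min_cost w n j k"
      using min_cost_triangle[OF att] d by blast
    then show ?thesis using le 4 d nn[of j n] by auto
  qed
qed

lemma solution_min_Suc:
  assumes "min_cost_attained w n" and "{i, j, k} = pegs"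
  shows "solution w (Suc n) (perfect (Suc n) i)
    (min (min_cost w n i k + w n k + min_cost w n k j)
      (min_cost w n i j + w n j + min_cost w n j i + w n i + min_cost w n i j))
    (perfect (Suc n) j)"
  using solution_move_once[OF assms] solution_move_twice[OF assms]
  by (auto simp: min_def)

lemma min_cost_attained:
  assumes nonneg: "\<forall>r. \<forall>k\<in>pegs. w r k \<ge> 0"
  shows "min_cost_attained w n"
proof (induction n)
  case 0
  have "perfect 0 i = perfect 0 j" for i j by (auto simp: perfect_def)
  then have "solution w 0 (perfect 0 i) 0 (perfect 0 j)" if "i \<in> pegs" for i j
    using that solution.empty[OF perfect_in_states] by metis
  moreover from this have "min_cost w 0 i j = 0" if "i \<in> pegs" for i j
    using that by (intro min_cost_eqI) (auto intro: solution_nonneg[OF _ nonneg])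
  ultimately show ?case
    unfolding min_cost_attained_def by (auto intro: solution_nonneg[OF _ nonneg])
next
  case (Suc n)
  show ?case
    unfolding min_cost_attained_def
  proof (intro ballI)
    fix i j assume ij: "i \<in> pegs" "j \<in> pegs"
    have "\<exists>c. solution w (Suc n) (perfect (Suc n) i) c (perfect (Suc n) j) \<and>
      (\<forall>c'. solution w (Suc n) (perfect (Suc n) i) c' (perfect (Suc n) j) \<longrightarrow> c \<le> c')"
    proof (cases "i = j")
      case True
      then show ?thesis
        using ij by (intro exI[of _ 0])
          (auto intro: solution_nonneg[OF _ nonneg] solution.empty perfect_in_states)
    next
      case False
      then obtain k where "{i, j, k} = pegs" using third_peg ij by blast
      then show ?thesis
        using solution_min_Suc[OF Suc] solution_Suc_ge[OF nonneg Suc] by blast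
    qed
    then show "solution w (Suc n) (perfect (Suc n) i) (min_cost w (Suc n) i j)
        (perfect (Suc n) j) \<and>
      (\<forall>c. solution w (Suc n) (perfect (Suc n) i) c (perfect (Suc n) j) \<longrightarrow>
        min_cost w (Suc n) i j \<le> c)"
      using min_cost_eqI by metis
  qed
qed

theorem min_cost_Suc:
  assumes "\<forall>r. \<forall>k\<in>pegs. w r k \<ge> 0" and "{i, j, k} = pegs"
  shows "min_cost w (Suc n) i j =
    min (min_cost w n i k + w n k + min_cost w n k j)
      (min_cost w n i j + w n j + min_cost w n j i + w n i + min_cost w n i j)"
  using assms
  by (intro min_cost_eqI solution_min_Suc solution_Suc_ge min_cost_attained)

lemma min_cost_0:
  assumes "\<forall>r. \<forall>k\<in>pegs. w r k \<ge> 0" and "i \<in> pegs"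
  shows "min_cost w 0 i j = 0"
proof -
  have "perfect 0 j = perfect 0 i" by (auto simp: perfect_def)
  then show ?thesis using min_cost_self[OF assms, of 0] by (simp add: min_cost_def)
qed

section \<open>Jacobsthal and Lichtenberg numbers\<close>

lemma jacobsthal_rec: "jacobsthal (n + 2) = jacobsthal (n + 1) + 2 * jacobsthal n"
  by (simp add: jacobsthal_def field_simps)

lemma lichtenberg_neg: "t < 0 \<Longrightarrow> lichtenberg t = 0"
  by (simp add: lichtenberg_def)

lemma lichtenberg_step: "lichtenberg (int n) = lichtenberg (int n - 1) + jacobsthal n"
proof -
  have "{0..int n} = insert (int n) {0..int n - 1}" by auto
  then show ?thesis by (simp add: lichtenberg_def)
qed

lemma jacobsthal_Suc_lichtenberg: "jacobsthal (n + 1) = 2 * lichtenberg (int n - 1) + 1"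
proof (induction n)
  case 0
  then show ?case by (simp add: lichtenberg_neg jacobsthal_def)
next
  case (Suc n)
  then show ?case
    using jacobsthal_rec[of n] lichtenberg_step[of n] by simp
qed

lemma lichtenberg_rec:
  "lichtenberg (int n + 1) = lichtenberg (int n) + 2 * lichtenberg (int n - 1) + 1"
  using lichtenberg_step[of "Suc n"] jacobsthal_Suc_lichtenberg[of n] by (simp add: add.commute)

section \<open>Costs with one exceptional pair of pegs\<close>

lemma min_cost_Suc_two_values:
  fixes w :: real
  assumes nonneg: "\<forall>r. \<forall>k\<in>pegs. cost r k \<ge> 0"
    and cost: "cost n 0 = 1" "cost n 2 = 1" "cost n 1 = w"
    and IH: "\<And>i j k. {i, j, k} = pegs \<Longrightarrow> min_cost cost n i j = [x, y, x] ! k"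
    and pegs: "{i, j, k} = pegs"
  shows "min_cost cost (Suc n) i j =
    [min (x + y + 1) (3 * x + 1 + w), min (2 * x + w) (3 * y + 2),
     min (x + y + 1) (3 * x + 1 + w)] ! k"
proof -
  note d = pegs_distinct[OF pegs]
  have "{i, k, j} = pegs" "{k, j, i} = pegs" "{j, i, k} = pegs" using pegs by auto
  note v = IH[OF pegs] this[THEN IH]
  have "k = 0 \<and> i = 1 \<and> j = 2 \<or> k = 0 \<and> i = 2 \<and> j = 1 \<or> k = 1 \<and> i = 0 \<and> j = 2 \<or>
      k = 1 \<and> i = 2 \<and> j = 0 \<or> k = 2 \<and> i = 0 \<and> j = 1 \<or> k = 2 \<and> i = 1 \<and> j = 0"
    using d unfolding pegs_def by auto
  then show ?thesis
    unfolding min_cost_Suc[OF nonneg pegs] v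
    using cost by (auto simp: algebra_simps min_def simp flip: One_nat_def)
qed

lemma min_cost_upto_threshold:
  fixes w :: nat
  assumes nonneg: "\<forall>r. \<forall>k\<in>pegs. cost r k \<ge> 0"
    and cost: "\<And>r. cost r 0 = 1" "\<And>r. cost r 2 = 1" "\<And>r. cost r 1 = real w"
    and w: "threshold m \<le> w" and "n \<le> m" and "{i, j, k} = pegs"
  shows "min_cost cost n i j = [N n, 2 * N n, N n] ! k"
  using assms(6,7)
proof (induction n arbitrary: i j k)
  case 0
  have "i \<in> pegs" "k \<in> pegs" using pegs_distinct[OF 0(2)] by auto
  then show ?case
    using min_cost_0[of cost, OF nonneg] by (auto simp: N_def pegs_def)
next
  case (Suc n)
  have "(3::nat) ^ n \<le> 3 ^ (m - 1)" using Suc.prems by (intro power_increasing) auto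
  moreover have "threshold m = 2 * 3 ^ (m - 1)" using Suc.prems by (cases m) auto
  ultimately have "real (2 * 3 ^ n) \<le> real w" using w by (simp only: of_nat_le_iff)
  then have "2 * 3 ^ n \<le> real w" by simp
  then have N: "4 * N n + 2 \<le> real w" "N (Suc n) = 3 * N n + 1" "N n \<ge> 0"
    by (auto simp: N_def field_simps)
  have "min_cost cost n i j = [N n, 2 * N n, N n] ! k" if "{i, j, k} = pegs" for i j k
    using Suc that by simp
  note step = min_cost_Suc_two_values[OF nonneg cost this Suc.prems(2)]
  have "min (N n + 2 * N n + 1) (3 * N n + 1 + real w) = N (Suc n)"
    "min (2 * N n + real w) (3 * (2 * N n) + 2) = 2 * N (Suc n)"
    using N by auto
  then show ?case using step by simp
qed

text \<open>
  The last three conclusions are what keeps the direct moves optimal: \<open>y \<le> 2 x\<close> for the pairs of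
  pegs with cost \<open>1\<close>, and \<open>2 x + w \<le> 3 y + 2\<close> for the pair with cost \<open>w\<close>. The bound \<open>w \<le> y\<close> serves
  to carry the first of them over to the next disc.
\<close>

lemma min_cost_beyond_threshold:
  fixes w m u :: nat
  defines "x \<equiv> \<lambda>t. N m * jacobsthal (t + 2) + lichtenberg (int t)
      + real w * lichtenberg (int t - 1)"
  defines "y \<equiv> \<lambda>t. 2 * N m * jacobsthal (t + 1) + 2 * lichtenberg (int t - 1)
      + 2 * real w * lichtenberg (int t - 2) + real w"
  assumes nonneg: "\<forall>r. \<forall>k\<in>pegs. cost r k \<ge> 0"
    and cost: "\<And>r. cost r 0 = 1" "\<And>r. cost r 2 = 1" "\<And>r. cost r 1 = real w"
    and w: "threshold m \<le> w" "w < threshold (m + 1)"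
  shows "(\<forall>i j k. {i, j, k} = pegs \<longrightarrow>
      min_cost cost (m + Suc u) i j = [x (Suc u), y (Suc u), x (Suc u)] ! k) \<and>
    y (Suc u) \<le> 2 * x (Suc u) \<and> 2 * x (Suc u) + real w \<le> 3 * y (Suc u) + 2 \<and>
    real w \<le> y (Suc u)"
proof (induction u)
  case 0
  have "real w < real (2 * 3 ^ m)" using w(2) by (simp only: of_nat_less_iff) simp
  then have N: "real w \<le> 4 * N m + 2" "N m \<ge> 0" by (auto simp: N_def field_simps)
  have x: "x (Suc 0) = 3 * N m + 1" and y: "y (Suc 0) = 2 * N m + real w"
    using lichtenberg_rec[of 0] lichtenberg_step[of 0]
    by (auto simp: x_def y_def lichtenberg_neg jacobsthal_def numeral_eq_Suc)
  note step = min_cost_Suc_two_values[OF nonneg cost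
      min_cost_upto_threshold[OF nonneg cost w(1) order_refl]]
  have "min (N m + 2 * N m + 1) (3 * N m + 1 + real w) = x (Suc 0)"
    "min (2 * N m + real w) (3 * (2 * N m) + 2) = y (Suc 0)"
    using N x y by auto
  then show ?case using step N x y by auto
next
  case (Suc u)
  define X Y where "X = x (Suc u)" and "Y = y (Suc u)"
  have IH: "\<And>i j k. {i, j, k} = pegs \<Longrightarrow> min_cost cost (m + Suc u) i j = [X, Y, X] ! k"
    "Y \<le> 2 * X" "2 * X + real w \<le> 3 * Y + 2" "real w \<le> Y"
    using Suc by (auto simp: X_def Y_def)
  have "x (Suc (Suc u)) = X + Y + 1"
    using jacobsthal_rec[of "Suc u + 1"] lichtenberg_rec[of "Suc u"] lichtenberg_rec[of u]
    by (simp add: x_def X_def y_def Y_def algebra_simps)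
  moreover have "y (Suc (Suc u)) = 2 * X + real w"
    by (simp add: x_def X_def y_def Y_def algebra_simps)
  ultimately show ?case
    using min_cost_Suc_two_values[OF nonneg cost IH(1)] IH(2-4) by (auto simp: min_def)
qed

theorem theorem5:
  fixes cost :: "nat \<Rightarrow> nat \<Rightarrow> real" and w m n i j k :: nat
  assumes "\<And>r. cost r 0 = 1" and "\<And>r. cost r 2 = 1" and "\<And>r. cost r 1 = real w"
    and "threshold m \<le> w" and "w < threshold (m + 1)"
    and "{i, j, k} = pegs"
  shows "min_cost cost n i j =
    (if n \<le> m then [N n, 2 * N n, N n] ! k
     else
       [N m * jacobsthal (n - m + 2) + lichtenberg (int n - int m)
          + real w * lichtenberg (int n - int m - 1),
        2 * N m * jacobsthal (n - m + 1) + 2 * lichtenberg (int n - int m - 1)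
          + 2 * real w * lichtenberg (int n - int m - 2) + real w,
        N m * jacobsthal (n - m + 2) + lichtenberg (int n - int m)
          + real w * lichtenberg (int n - int m - 1)] ! k)"
proof -
  have nonneg: "\<forall>r. \<forall>k\<in>pegs. cost r k \<ge> 0"
    using assms(1-3) by (auto simp: pegs_def simp flip: One_nat_def)
  show ?thesis
  proof (cases "n \<le> m")
    case True
    then show ?thesis
      using min_cost_upto_threshold[OF nonneg assms(1-4) _ assms(6)] by simp
  next
    case False
    then obtain t where n: "n = m + Suc t" using less_imp_add_positive[of m n]
      by (metis add_Suc_right less_natE not_le)
    have "n - m = Suc t" "int n - int m = int (Suc t)" using n by auto
    then show ?thesis
      using min_cost_beyond_threshold[OF nonneg assms(1-5), of t] assms(6) False
      unfolding n by (simp only: if_False)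
  qed
qed

end
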